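(* Let $\mathbb{F}=\mathbb{Z}$ or $\mathbb{F}=\mathbb{R}$, let $\mathcal{L}\subset\mathbb{F}^n$ be a finite set, and consider the differential equation $\dot{\mathbf{x}}=\mathbf{f}(\mathbf{x})$ on $D$ with $$f_i(\mathbf{x})=\sum_{\mathbf{l}\in\mathcal{L}}a^i_{\mathbf{l}}\,\mathbf{x}^{\mathbf{l}},\qquad a^i_{\mathbf{l}}\in\mathbb{R},\quad i=1,\dots,n,$$ and suppose $\mathbf{f}$ is divergence-free. Let $$0=\sum_{\mathbf{j}\in\mathcal{J}}p_{\mathbf{j}}\,\mathbf{x}^{\mathbf{j}}$$ be the corresponding divergence-free condition. For each multi-index $\mathbf{j}\in\mathcal{J}$ there exists the associated elementary divergence-free vector field $$\dot x_i=(1-\delta_{i,l})\,a^i_{\mathbf{j}+\mathbf{e}_i}\,x_i\,\mathbf{x}^{\mathbf{j}},\qquad i=1,\dots,n,$$ where $\delta_{i,l}$ is the Kronecker delta and $l$ is any index such that $j_l=-1$; that is, the $i$-th component is $0$ for every $i$ with $j_i=-1$, and is $a^i_{\mathbf{j}+\mathbf{e}_i}x_i\mathbf{x}^{\mathbf{j}}$ for every $i$ with $j_i\neq-1$. These vector fields can be written in the form $$\dot x_i=a_i\,x_i\,\mathbf{x}^{\mathbf{j}},\qquad i=1,\dots,n,$$ with $\mathbf{a}=(a_1,\dots,a_n)^T\in\mathbb{R}^n$ constant (depending on $\mathbf{j}$). They are volume preserving (divergence-free) and possess $n-1$ independent integrals of motion, hence they are integrable. Their solution is explicitly given as follows: with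 $c_{\mathbf{j}}=\mathbf{a}^T\mathbf{j}$, for any initial value $\mathbf{x}(t_0)\in D$ and any $\Delta t>0$ with $\Delta t<1/|c_{\mathbf{j}}\mathbf{x}^{\mathbf{j}}(t_0)|$ (no restriction if $c_{\mathbf{j}}=0$), for $t\in[t_0,t_0+\Delta t]$ and $i=1,\dots,n$, $$x_i(t)=\begin{cases} x_i(t_0)\Big(1-c_{\mathbf{j}}\,\mathbf{x}^{\mathbf{j}}(t_0)(t-t_0)\Big)^{-a_i/c_{\mathbf{j}}} & \text{if } c_{\mathbf{j}}\neq0,\\[4pt] x_i(t_0)\,\mathrm{e}^{a_i\mathbf{x}^{\mathbf{j}}(t_0)(t-t_0)} & \text{if } c_{\mathbf{j}}=0.\end{cases}$$
   Context: For $\mathbf{j}=(j_1,\dots,j_n)\in\mathbb{F}^n$, $\mathbf{x}^{\mathbf{j}}=x_1^{j_1}\cdots x_n^{j_n}$. The domain is $D=\{\mathbf{x}\in\mathbb{R}^n: x_i\neq0\ \forall i\}$ if $\mathbb{F}=\mathbb{Z}$, and $D=\{\mathbf{x}\in\mathbb{R}^n: x_i>0\ \forall i\}$ if $\mathbb{F}=\mathbb{R}$. $\mathbf{e}_i$ is the $i$-th canonical unit vector. Coefficients $a^i_{\mathbf{m}}$ with $\mathbf{m}\notin\mathcal{L}$ are taken to be $0$. Divergence-free means $\sum_{i=1}^n\partial_{x_i}f_i=0$ on $D$. $\mathcal{J}\subset\mathbb{F}^n$ is the finite set of exponents arising when the terms $\partial_{x_i}(a^i_{\mathbf{l}}\mathbf{x}^{\mathbf{l}})=a^i_{\mathbf{l}}l_i\mathbf{x}^{\mathbf{l}-\mathbf{e}_i}$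 are collected by monomials, and $p_{\mathbf{j}}$ is the resulting coefficient of $\mathbf{x}^{\mathbf{j}}$, i.e. $p_{\mathbf{j}}=\sum_{i=1}^n(j_i+1)a^i_{\mathbf{j}+\mathbf{e}_i}$. An integral of motion is a function constant along solutions; integrals are independent if their gradients are linearly independent (at each point of $D$); a system in $\mathbb{R}^n$ is called integrable here if it possesses $n-1$ independent integrals of motion. *)

theory Defs imports "HOL-Analysis.Analysis" begin

text \<open>Integer exponents act by integer powers (also on a negative base), all others by
  \<^const>\<open>powr\<close>. For a positive base the two agree on integer exponents, so this one function serves
  both kinds of exponents; on the phase spaces below it is never used with a nonpositive base
  and a non-integer exponent.\<close>
definition rpow :: "real \<Rightarrow> real \<Rightarrow> real" where
  "rpow x r = (if r \<in> \<int> then x powi \<lfloor>r\<rfloor> else x powr r)"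

definition monomial :: "real ^ 'n \<Rightarrow> real ^ 'n \<Rightarrow> real" where
  "monomial j x = (\<Prod>i\<in>UNIV. rpow (x $ i) (j $ i))"

text \<open>The argument is the set of admissible exponents, either \<^term>\<open>\<int> :: real set\<close> or
  \<^term>\<open>\<real> :: real set\<close>.\<close>
definition phase_space :: "real set \<Rightarrow> (real ^ 'n) set" where
  "phase_space F = (if F = \<int> then {x. \<forall>i. x $ i \<noteq> 0} else {x. \<forall>i. x $ i > 0})"

definition monomial_field ::
    "(real ^ 'n) set \<Rightarrow> ('n \<Rightarrow> real ^ 'n \<Rightarrow> real) \<Rightarrow> real ^ 'n \<Rightarrow> real ^ 'n" where
  "monomial_field L a x = (\<chi> i. \<Sum>l\<in>L. a i l * monomial l x)"

definition divergence :: "(real ^ 'n \<Rightarrow> real ^ 'n) \<Rightarrow> real ^ 'n \<Rightarrow> real" where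
  "divergence f x = (\<Sum>i\<in>UNIV. frechet_derivative f (at x) (axis i 1) $ i)"

definition divergence_free_on :: "(real ^ 'n) set \<Rightarrow> (real ^ 'n \<Rightarrow> real ^ 'n) \<Rightarrow> bool" where
  "divergence_free_on D f \<longleftrightarrow> (\<forall>x\<in>D. f differentiable (at x) \<and> divergence f x = 0)"

text \<open>The exponents of the formal terms
  \<open>\<partial>\<^sub>i (a i l x\<^sup>l) = a i l * l\<^sub>i x\<^bsup>l - e\<^sub>i\<^esup>\<close> of the divergence; exponents all of whose terms
  happen to have coefficient zero are not discarded.\<close>
definition div_exponents :: "(real ^ 'n) set \<Rightarrow> (real ^ 'n) set" where
  "div_exponents L = {l - axis i 1 | l i. l \<in> L}"

definition div_coeff :: "('n \<Rightarrow> real ^ 'n \<Rightarrow> real) \<Rightarrow> real ^ 'n \<Rightarrow> real" where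
  "div_coeff a j = (\<Sum>i\<in>UNIV. (j $ i + 1) * a i (j + axis i 1))"

definition elementary_field ::
    "('n \<Rightarrow> real ^ 'n \<Rightarrow> real) \<Rightarrow> real ^ 'n \<Rightarrow> real ^ 'n \<Rightarrow> real ^ 'n" where
  "elementary_field a j x =
     (\<chi> i. if j $ i = -1 then 0 else a i (j + axis i 1) * x $ i * monomial j x)"

definition solution_on ::
    "(real ^ 'n) set \<Rightarrow> (real ^ 'n \<Rightarrow> real ^ 'n) \<Rightarrow> real set \<Rightarrow> (real \<Rightarrow> real ^ 'n) \<Rightarrow> bool" where
  "solution_on D f T x \<longleftrightarrow>
     (\<forall>t\<in>T. x t \<in> D \<and> (x has_vector_derivative f (x t)) (at t within T))"

definition integral_of_motion ::
    "(real ^ 'n) set \<Rightarrow> (real ^ 'n \<Rightarrow> real ^ 'n) \<Rightarrow> (real ^ 'n \<Rightarrow> real) \<Rightarrow> bool" where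
  "integral_of_motion D f H \<longleftrightarrow>
     (\<forall>T x. is_interval T \<and> solution_on D f T x \<longrightarrow> (\<lambda>t. H (x t)) constant_on T)"

text \<open>\<^const>\<open>independent\<close> speaks about a set of vectors; injectivity excludes repetitions in the
  family of gradients.\<close>
definition gradient_independent_on ::
    "(real ^ 'n) set \<Rightarrow> nat \<Rightarrow> (nat \<Rightarrow> real ^ 'n \<Rightarrow> real) \<Rightarrow> bool" where
  "gradient_independent_on D m H \<longleftrightarrow>
     (\<forall>x\<in>D. \<exists>g. (\<forall>k<m. GDERIV (H k) x :> g k) \<and>
        inj_on g {..<m} \<and> independent (g ` {..<m}))"

definition integrable_system :: "(real ^ 'n) set \<Rightarrow> (real ^ 'n \<Rightarrow> real ^ 'n) \<Rightarrow> bool" where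
  "integrable_system D f \<longleftrightarrow>
     (\<exists>H. (\<forall>k<CARD('n) - 1. integral_of_motion D f (H k)) \<and>
        gradient_independent_on D (CARD('n) - 1) H)"

definition explicit_flow ::
    "real ^ 'n \<Rightarrow> real ^ 'n \<Rightarrow> real \<Rightarrow> real ^ 'n \<Rightarrow> real \<Rightarrow> real ^ 'n" where
  "explicit_flow a j t0 x0 t =
     (let c = a \<bullet> j in
      \<chi> i. if c \<noteq> 0
          then x0 $ i * (1 - c * monomial j x0 * (t - t0)) powr (- (a $ i / c))
          else x0 $ i * exp (a $ i * monomial j x0 * (t - t0)))"

end

theory Submission imports Defs begin

text \<open>Substituting \<open>x\<^sub>i = exp y\<^sub>i\<close> turns monomials into exponentials of distinct linear forms, which are
  linearly independent; so every \<open>p\<^sub>j\<close> vanishes, which says precisely that the elementary field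
  belonging to \<open>j\<close> is divergence-free. Along \<open>x\<^sub>i' = \<alpha>\<^sub>i x\<^sub>i x\<^sup>j\<close> the functions
  \<open>\<Sum>\<^sub>i b\<^sub>i ln \<bar>x\<^sub>i\<bar>\<close> with \<open>b \<bottom> \<alpha>\<close> are conserved, and \<open>u = x\<^sup>j\<close> solves \<open>u' = (\<alpha> \<bullet> j) u\<^sup>2\<close>. Hence
  \<open>1/u\<close> is affine in time, \<open>u\<close> is known, and what remains for the \<open>x\<^sub>i\<close> is linear.\<close>

section \<open>Powers and monomials at admissible points\<close>

text \<open>A pointwise condition that treats both kinds of exponents at once: an integer exponent
  asks only for a nonzero base, any other exponent for a positive one. Under it \<open>rpow\<close>
  obeys the power and differentiation rules used below.\<close>

definition admissible :: "real ^ 'n \<Rightarrow> real ^ 'n \<Rightarrow> bool" where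
  "admissible j x \<longleftrightarrow> (\<forall>i. x $ i \<noteq> 0 \<and> (j $ i \<in> \<int> \<or> x $ i > 0))"

lemma rpow_nonzero: "x \<noteq> 0 \<Longrightarrow> rpow x r \<noteq> 0"
  by (simp add: rpow_def)

lemma rpow_diff_one:
  assumes "x \<noteq> 0" "r \<in> \<int> \<or> x > 0"
  shows "rpow x (r - 1) = rpow x r / x"
proof (cases "r \<in> \<int>")
  case True
  then show ?thesis
    using assms by (auto simp: rpow_def power_int_diff elim!: Ints_cases)
next
  case False
  then have "r - 1 \<notin> \<int>"
    by (metis Ints_1 Ints_add diff_add_cancel)
  with False show ?thesis
    using assms by (simp add: rpow_def powr_diff)
qed

lemma rpow_mult_exp:
  assumes "r \<in> \<int> \<or> x > 0"
  shows "rpow (x * exp z) r = rpow x r * exp (r * z)"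
proof (cases "r \<in> \<int>")
  case True
  then obtain n where n: "r = of_int n"
    by (auto elim: Ints_cases)
  have "exp z powi n = exp (r * z)"
    by (simp add: n exp_power_int)
  then show ?thesis
    by (simp add: rpow_def n power_int_mult_distrib)
next
  case False
  then show ?thesis
    using assms by (simp add: rpow_def powr_mult exp_powr_real mult.commute)
qed

lemma has_real_derivative_rpow:
  assumes "x \<noteq> 0" "r \<in> \<int> \<or> x > 0"
  shows "((\<lambda>x. rpow x r) has_real_derivative r * rpow x r / x) (at x within S)"
proof (cases "r \<in> \<int>")
  case True
  then obtain n where n: "r = of_int n"
    by (auto elim: Ints_cases)
  have "((\<lambda>x. x powi n) has_real_derivative of_int n * x powi (n - 1) * 1) (at x within S)"
    using assms by (intro DERIV_power_int DERIV_ident) auto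
  then show ?thesis
    using assms by (simp add: rpow_def n power_int_diff)
next
  case False
  have "((\<lambda>x. x powr r) has_real_derivative r * x powr (r - 1)) (at x)"
    using assms False by (intro has_real_derivative_powr) auto
  then show ?thesis
    using assms False
    by (auto simp: rpow_def powr_diff intro: has_field_derivative_at_within)
qed

lemma monomial_nonzero: "(\<And>i. x $ i \<noteq> 0) \<Longrightarrow> monomial j x \<noteq> 0"
  by (simp add: monomial_def rpow_nonzero)

lemma monomial_diff_axis:
  assumes "admissible l x"
  shows "monomial (l - axis i 1) x = monomial l x / x $ i"
proof -
  have "(\<Prod>k\<in>UNIV - {i}. rpow (x $ k) ((l - axis i 1) $ k)) = (\<Prod>k\<in>UNIV - {i}. rpow (x $ k) (l $ k))"
    by (intro prod.cong) (auto simp: axis_def)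
  moreover have "rpow (x $ i) ((l - axis i 1) $ i) = rpow (x $ i) (l $ i) / x $ i"
    using assms by (simp add: admissible_def axis_def rpow_diff_one)
  ultimately show ?thesis
    by (simp add: monomial_def prod.remove[of UNIV i])
qed

text \<open>Positive factors leave the signs of the coordinates alone, so negative coordinates are
  allowed when the exponents are integers. It serves twice: for the substitution of exponentials for
  the coordinates, and for evaluating a monomial along a solution, where each coordinate is its
  initial value times an exponential.\<close>

lemma monomial_mult_exp:
  assumes "admissible j x"
  shows "monomial j (\<chi> i. x $ i * exp (z i)) = monomial j x * exp (\<Sum>i\<in>UNIV. j $ i * z i)"
  using assms by (simp add: monomial_def admissible_def rpow_mult_exp prod.distrib exp_sum)

lemma monomial_exp: "monomial j (\<chi> i. exp (y $ i)) = exp (j \<bullet> y)"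
proof -
  have "monomial j (\<chi> i. 1) = 1"
    by (auto simp: monomial_def rpow_def intro!: prod.neutral)
  then show ?thesis
    using monomial_mult_exp[of j "\<chi> i. 1" "\<lambda>i. y $ i"]
    by (simp add: admissible_def inner_vec_def)
qed

text \<open>This is logarithmic differentiation: the factor that the product rule omits is restored
  by dividing by \<open>x $ i\<close>, so the whole monomial can be pulled out of the sum.\<close>

lemma monomial_has_derivative:
  assumes "admissible l x"
  shows "(monomial l has_derivative (\<lambda>h. monomial l x * (\<Sum>i\<in>UNIV. l $ i * h $ i / x $ i)))
           (at x within S)"
proof -
  have comp: "((\<lambda>y. rpow (y $ i) (l $ i)) has_derivative
      (\<lambda>h. h $ i * (l $ i * rpow (x $ i) (l $ i) / x $ i))) (at x within S)" for i
  proof -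
    have "((\<lambda>y. rpow y (l $ i)) has_derivative (*) (l $ i * rpow (x $ i) (l $ i) / x $ i)) (at (x $ i))"
      using has_real_derivative_rpow[of "x $ i" "l $ i" UNIV] assms
      by (simp add: admissible_def has_field_derivative_def)
    from has_derivative_compose[OF bounded_linear_imp_has_derivative[OF bounded_linear_vec_nth] this]
    show ?thesis
      by (simp add: mult.commute)
  qed
  have nz: "rpow (x $ i) (l $ i) \<noteq> 0" for i
    using assms by (simp add: admissible_def rpow_nonzero)
  have "((\<lambda>y. \<Prod>i\<in>UNIV. rpow (y $ i) (l $ i)) has_derivative
      (\<lambda>h. \<Sum>i\<in>UNIV. h $ i * (l $ i * rpow (x $ i) (l $ i) / x $ i) *
        (\<Prod>k\<in>UNIV - {i}. rpow (x $ k) (l $ k)))) (at x within S)"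
    by (intro has_derivative_prod comp)
  moreover have "h $ i * (l $ i * rpow (x $ i) (l $ i) / x $ i) *
        (\<Prod>k\<in>UNIV - {i}. rpow (x $ k) (l $ k)) = monomial l x * (l $ i * h $ i / x $ i)" for h i
    by (simp add: monomial_def prod.remove[of UNIV i])
  ultimately have "((\<lambda>y. \<Prod>i\<in>UNIV. rpow (y $ i) (l $ i)) has_derivative
      (\<lambda>h. monomial l x * (\<Sum>i\<in>UNIV. l $ i * h $ i / x $ i))) (at x within S)"
    by (simp only: sum_distrib_left)
  then show ?thesis
    by (simp only: monomial_def[abs_def])
qed

section \<open>Divergence of monomial fields and linear independence of exponentials\<close>

lemma has_derivative_vec_lambda:
  fixes f :: "'a :: real_normed_vector \<Rightarrow> 'n :: finite \<Rightarrow> real"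
  assumes "\<And>i. ((\<lambda>x. f x i) has_derivative f' i) (at x within S)"
  shows "((\<lambda>x. \<chi> i. f x i) has_derivative (\<lambda>h. \<chi> i. f' i h)) (at x within S)"
  using assms
  by (subst has_derivative_componentwise_within) (auto simp: Basis_vec_def inner_axis)

lemma divergence_eq:
  assumes "(f has_derivative f') (at x)"
  shows "divergence f x = (\<Sum>i\<in>UNIV. f' (axis i 1) $ i)"
  by (simp add: divergence_def frechet_derivative_at[OF assms, symmetric])

text \<open>Induction on the exponent set. Dividing by the exponential of one exponent
  \<open>k\<close> and differentiating in a direction \<open>d\<close> removes that term and
  multiplies every other coefficient by \<open>(j - k) \<bullet> d\<close>. The induction hypothesis
  applies to these new coefficients, which is why \<open>p\<close> is generalized.\<close>

lemma sum_exp_inner_eq_zero: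
  fixes J :: "('a :: real_inner) set"
  assumes "finite J" "\<And>y. (\<Sum>j\<in>J. p j * exp (j \<bullet> y)) = 0" "j \<in> J"
  shows "p j = 0"
  using assms
proof (induction J arbitrary: p j rule: finite_induct)
  case empty
  then show ?case by simp
next
  case (insert k J)
  have "(\<Sum>j\<in>J. (p j * ((j - k) \<bullet> d)) * exp (j \<bullet> y)) = 0" for d y
  proof -
    \<comment> \<open>This is the quotient of the vanishing sum by the exponential of
      \<open>k\<close>, restricted to the line through \<open>y\<close> in direction
      \<open>d\<close>. Its \<open>k\<close>-term does not depend on \<open>s\<close>.\<close>
    define h where "h s = (\<Sum>j\<in>insert k J. p j * exp ((j - k) \<bullet> (y + s *\<^sub>R d)))" for s
    have "h s = exp (- (k \<bullet> (y + s *\<^sub>R d))) * (\<Sum>j\<in>insert k J. p j * exp (j \<bullet> (y + s *\<^sub>R d)))" for s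
      unfolding h_def sum_distrib_left
      by (intro sum.cong) (simp_all add: inner_diff_left exp_diff exp_minus field_simps)
    then have "h = (\<lambda>s. 0)"
      using insert.prems(1) by (simp add: fun_eq_iff)
    moreover have "(h has_real_derivative
        (\<Sum>j\<in>insert k J. p j * (exp ((j - k) \<bullet> y) * ((j - k) \<bullet> d)))) (at 0)"
      unfolding h_def inner_add_right inner_scaleR_right
      by (intro DERIV_sum) (auto intro!: derivative_eq_intros)
    ultimately have "(\<Sum>j\<in>insert k J. p j * (exp ((j - k) \<bullet> y) * ((j - k) \<bullet> d))) = 0"
      by (metis DERIV_const DERIV_unique)
    then have "(\<Sum>j\<in>J. p j * (exp ((j - k) \<bullet> y) * ((j - k) \<bullet> d))) = 0"
      using insert.hyps by simp
    moreover have "(\<Sum>j\<in>J. (p j * ((j - k) \<bullet> d)) * exp (j \<bullet> y)) =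
        exp (k \<bullet> y) * (\<Sum>j\<in>J. p j * (exp ((j - k) \<bullet> y) * ((j - k) \<bullet> d)))"
      unfolding sum_distrib_left
      by (intro sum.cong) (simp_all add: inner_diff_left exp_diff)
    ultimately show ?thesis by simp
  qed
  then have IH: "p i * ((i - k) \<bullet> d) = 0" if "i \<in> J" for i d
    using insert.IH[of "\<lambda>j. p j * ((j - k) \<bullet> d)" i] that by simp
  \<comment> \<open>The direction \<open>d = i - k\<close> turns the extra factor into the squared
    norm of \<open>i - k\<close>, which is positive because \<open>k\<close> lies outside
    \<open>J\<close>.\<close>
  have zero: "p i = 0" if "i \<in> J" for i
    using IH[OF that, of "i - k"] that insert.hyps by auto
  then have "(\<Sum>j\<in>J. p j) = 0"
    by simp
  \<comment> \<open>At the origin all exponentials are 1, and only the coefficient of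
    \<open>k\<close> is left.\<close>
  moreover have "(\<Sum>j\<in>insert k J. p j * exp (j \<bullet> 0)) = 0"
    by (rule insert.prems(1))
  ultimately have "p k = 0"
    using insert.hyps by simp
  with zero insert.prems(2) show ?case by blast
qed

lemma monomial_field_has_derivative:
  assumes "\<And>l. l \<in> L \<Longrightarrow> admissible l x"
  shows "(monomial_field L a has_derivative
    (\<lambda>h. \<chi> i. \<Sum>l\<in>L. a i l * (monomial l x * (\<Sum>k\<in>UNIV. l $ k * h $ k / x $ k)))) (at x)"
  unfolding monomial_field_def[abs_def]
  by (intro has_derivative_vec_lambda has_derivative_sum has_derivative_mult_right
      monomial_has_derivative assms)

lemma sum_axis: "(\<Sum>k\<in>UNIV. f k * axis i 1 $ k / g k) = f i / (g i :: real)"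
  by (subst sum.cong[OF refl, where h = "\<lambda>k. if k = i then f i / g i else 0"]) (auto simp: axis_def)

lemma finite_div_exponents: "finite L \<Longrightarrow> finite (div_exponents L)"
  by (rule finite_subset[of _ "(\<lambda>(l, i). l - axis i 1) ` (L \<times> UNIV)"])
    (auto simp: div_exponents_def)

text \<open>For fixed \<open>i\<close> the shift from \<open>l\<close> to
  \<open>l - axis i 1\<close> is injective, so the terms of each partial derivative can be reindexed
  by the resulting exponent. Exchanging the two sums then collects equal monomials.\<close>

lemma divergence_monomial_field:
  fixes L :: "(real ^ 'n) set"
  assumes "finite L" and adm: "\<And>l. l \<in> L \<Longrightarrow> admissible l x"
    and zero: "\<And>i m. m \<notin> L \<Longrightarrow> a i m = 0"
  shows "divergence (monomial_field L a) x = (\<Sum>j\<in>div_exponents L. div_coeff a j * monomial j x)"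
proof -
  let ?J = "div_exponents L"
  have "divergence (monomial_field L a) x =
      (\<Sum>i\<in>UNIV. \<Sum>l\<in>L. a i l * (monomial l x * (l $ i / x $ i)))"
    by (simp add: divergence_eq[OF monomial_field_has_derivative[OF adm]] sum_axis)
  also have "\<dots> = (\<Sum>i\<in>UNIV. \<Sum>l\<in>L. l $ i * a i l * monomial (l - axis i 1) x)"
    by (intro sum.cong refl) (simp add: monomial_diff_axis[OF adm])
  also have "\<dots> = (\<Sum>i\<in>UNIV. \<Sum>j\<in>?J. (j $ i + 1) * a i (j + axis i 1) * monomial j x)"
  proof (rule sum.cong[OF refl])
    fix i :: 'n
    have "(\<Sum>l\<in>L. l $ i * a i l * monomial (l - axis i 1) x) =
        (\<Sum>j\<in>(\<lambda>l. l - axis i 1) ` L. (j $ i + 1) * a i (j + axis i 1) * monomial j x)"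
      by (subst sum.reindex) (auto simp: inj_on_def axis_def)
    \<comment> \<open>To exchange the sums, the exponent range must be the same for every
      \<open>i\<close>. The exponents added here have \<open>j + axis i 1\<close> outside
      \<open>L\<close>, where \<open>a\<close> is 0.\<close>
    also have "\<dots> = (\<Sum>j\<in>?J. (j $ i + 1) * a i (j + axis i 1) * monomial j x)"
    proof (intro sum.mono_neutral_left finite_div_exponents assms ballI)
      show "(\<lambda>l. l - axis i 1) ` L \<subseteq> ?J"
        by (auto simp: div_exponents_def)
      fix j assume "j \<in> ?J - (\<lambda>l. l - axis i 1) ` L"
      then have "j + axis i 1 \<notin> L"
        by (metis DiffD2 add_diff_cancel_right' imageI)
      then show "(j $ i + 1) * a i (j + axis i 1) * monomial j x = 0"
        by (simp add: zero)
    qed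
    finally show "(\<Sum>l\<in>L. l $ i * a i l * monomial (l - axis i 1) x) =
        (\<Sum>j\<in>?J. (j $ i + 1) * a i (j + axis i 1) * monomial j x)" .
  qed
  also have "\<dots> = (\<Sum>j\<in>?J. div_coeff a j * monomial j x)"
    by (subst sum.swap) (simp add: div_coeff_def sum_distrib_right)
  finally show ?thesis .
qed

section \<open>The fields \<alpha>_i x_i x^j\<close>

text \<open>The constants \<alpha> are kept free of the coefficients \<open>a\<close>: the results
  on flows and integrals of motion hold for every \<alpha>, whether or not the field is
  divergence-free.\<close>

definition power_field :: "real ^ 'n \<Rightarrow> real ^ 'n \<Rightarrow> real ^ 'n \<Rightarrow> real ^ 'n" where
  "power_field \<alpha> j x = (\<chi> i. \<alpha> $ i * x $ i * monomial j x)"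

lemma power_field_has_derivative:
  assumes "admissible j x"
  shows "(power_field \<alpha> j has_derivative
    (\<lambda>h. \<chi> i. \<alpha> $ i * x $ i * (monomial j x * (\<Sum>k\<in>UNIV. j $ k * h $ k / x $ k)) +
       \<alpha> $ i * h $ i * monomial j x)) (at x)"
  unfolding power_field_def[abs_def]
  by (intro has_derivative_vec_lambda has_derivative_mult has_derivative_mult_right
      monomial_has_derivative assms bounded_linear_imp_has_derivative bounded_linear_vec_nth)

text \<open>In the factor \<open>j $ i + 1\<close>, the 1 comes from differentiating
  \<open>x $ i\<close> and the \<open>j $ i\<close> from differentiating the monomial.\<close>

lemma divergence_power_field:
  assumes "admissible j x"
  shows "divergence (power_field \<alpha> j) x = (\<Sum>i\<in>UNIV. (j $ i + 1) * \<alpha> $ i) * monomial j x"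
proof -
  have "x $ i \<noteq> 0" for i
    using assms by (simp add: admissible_def)
  then show ?thesis
    by (simp add: divergence_eq[OF power_field_has_derivative[OF assms]] sum_axis
        sum_distrib_left algebra_simps)
qed

section \<open>Evolution of the monomial and uniqueness of solutions\<close>

lemma solution_on_component:
  assumes "solution_on D f T x" "t \<in> T"
  shows "((\<lambda>t. x t $ i) has_real_derivative f (x t) $ i) (at t within T)"
  using assms
  by (auto simp: solution_on_def has_real_derivative_iff_has_vector_derivative
      intro: bounded_linear.has_vector_derivative[OF bounded_linear_vec_nth])

text \<open>Every coordinate has logarithmic rate \<alpha>_i u with the same u = x^j. Weighting
  these rates by the exponents gives the logarithmic rate \<open>\<alpha> \<bullet> j\<close> times
  u for u itself, so u satisfies a scalar equation of its own.\<close>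

lemma monomial_along_solution:
  assumes sol: "solution_on D (power_field \<alpha> j) T x" and t: "t \<in> T" and adm: "admissible j (x t)"
  shows "((\<lambda>t. monomial j (x t)) has_real_derivative (\<alpha> \<bullet> j) * (monomial j (x t))\<^sup>2) (at t within T)"
proof -
  let ?u = "monomial j (x t)"
  have nz: "x t $ i \<noteq> 0" for i
    using adm by (simp add: admissible_def)
  have "(x has_derivative (\<lambda>s. s *\<^sub>R power_field \<alpha> j (x t))) (at t within T)"
    using sol t by (simp add: solution_on_def has_vector_derivative_def)
  from has_derivative_compose[OF this monomial_has_derivative[OF adm]]
  have "((\<lambda>t. monomial j (x t)) has_derivative
      (\<lambda>s. ?u * (\<Sum>i\<in>UNIV. j $ i * (s *\<^sub>R power_field \<alpha> j (x t)) $ i / x t $ i))) (at t within T)" .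
  moreover have "?u * (\<Sum>i\<in>UNIV. j $ i * (s *\<^sub>R power_field \<alpha> j (x t)) $ i / x t $ i) =
      (\<alpha> \<bullet> j) * ?u\<^sup>2 * s" for s
  proof -
    have "j $ i * (s *\<^sub>R power_field \<alpha> j (x t)) $ i / x t $ i = \<alpha> $ i * j $ i * (?u * s)" for i
      using nz[of i] by (simp add: power_field_def)
    then show ?thesis
      by (simp add: inner_vec_def sum_distrib_right[symmetric] power2_eq_square)
  qed
  ultimately show ?thesis
    by (simp add: has_field_derivative_def fun_eq_iff[symmetric])
qed

lemma eq_if_derivative_zero:
  fixes f :: "real \<Rightarrow> real"
  assumes "convex T" "\<And>t. t \<in> T \<Longrightarrow> (f has_real_derivative 0) (at t within T)" "s \<in> T" "t \<in> T"
  shows "f s = f t"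
  using has_field_derivative_zero_constant[OF assms(1,2)] assms(3,4) by metis

text \<open>By the differential equation for \<open>x\<^sup>j\<close>, first the monomials and then the components of the two
  solutions are compared.\<close>
lemma power_field_solution_unique:
  assumes x: "solution_on D (power_field \<alpha> j) T x" and y: "solution_on D (power_field \<alpha> j) T y"
    and adm: "\<And>z. z \<in> D \<Longrightarrow> admissible j z"
    and T: "convex T" "t0 \<in> T" and init: "x t0 = y t0" and t: "t \<in> T"
  shows "x t = y t"
proof -
  have xD: "admissible j (x s)" "admissible j (y s)" if "s \<in> T" for s
    using x y that adm by (auto simp: solution_on_def)
  have nz: "x s $ i \<noteq> 0" "y s $ i \<noteq> 0" if "s \<in> T" for s i
    using xD[OF that] by (auto simp: admissible_def)
  have mnz: "monomial j (x s) \<noteq> 0" "monomial j (y s) \<noteq> 0" if "s \<in> T" for s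
    using nz[OF that] monomial_nonzero[of "x s"] monomial_nonzero[of "y s"] by auto
  have mono: "monomial j (x s) = monomial j (y s)" if s: "s \<in> T" for s
  proof -
    \<comment> \<open>Both inverses have the constant derivative
      \<open>- (\<alpha> \<bullet> j)\<close>, so their difference keeps its initial value
      0.\<close>
    let ?f = "\<lambda>s. inverse (monomial j (x s)) - inverse (monomial j (y s))"
    have "(?f has_real_derivative 0) (at r within T)" if r: "r \<in> T" for r
      by (rule derivative_eq_intros monomial_along_solution[OF x r xD(1)[OF r]]
          monomial_along_solution[OF y r xD(2)[OF r]] mnz[OF r] refl)+
        (use mnz[OF r] in \<open>simp add: power2_eq_square\<close>)
    from eq_if_derivative_zero[OF T(1) this s T(2)]
    have "?f s = 0"
      using init by simp
    then show ?thesis by simp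
  qed
  have "x t $ i = y t $ i" for i
  proof -
    \<comment> \<open>Once the monomials agree, both components solve the same linear scalar
      equation, so their quotient is constant.\<close>
    have "((\<lambda>s. x s $ i / y s $ i) has_real_derivative 0) (at r within T)" if r: "r \<in> T" for r
      by (rule derivative_eq_intros solution_on_component[OF x r] solution_on_component[OF y r]
          nz[OF r] refl)+
        (use nz[OF r] mono[OF r] in \<open>simp add: power_field_def\<close>)
    from eq_if_derivative_zero[OF T(1) this t T(2)]
    show ?thesis
      using nz[OF T(2)] nz[OF t] init by simp
  qed
  then show ?thesis
    by (simp add: vec_eq_iff)
qed

section \<open>Explicit solutions\<close>

text \<open>A change of time: with \<theta> as the new time, the derivative of which is the monomial
  along the curve, the system becomes linear with rates \<alpha>_i. The assumption on \<theta>
  states this with the monomial already evaluated on the candidate, so both cases of the explicit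
  formula fit it.\<close>

lemma solution_on_exp:
  assumes adm: "admissible j x0"
    and D: "\<And>t. t \<in> T \<Longrightarrow> (\<chi> i. x0 $ i * exp (\<alpha> $ i * \<theta> t)) \<in> D"
    and \<theta>: "\<And>t. t \<in> T \<Longrightarrow>
      (\<theta> has_real_derivative monomial j x0 * exp ((\<alpha> \<bullet> j) * \<theta> t)) (at t within T)"
  shows "solution_on D (power_field \<alpha> j) T (\<lambda>t. \<chi> i. x0 $ i * exp (\<alpha> $ i * \<theta> t))"
  unfolding solution_on_def
proof (intro ballI conjI D)
  fix t assume t: "t \<in> T"
  let ?x = "\<lambda>t. \<chi> i. x0 $ i * exp (\<alpha> $ i * \<theta> t)"
  have m: "monomial j (?x t) = monomial j x0 * exp ((\<alpha> \<bullet> j) * \<theta> t)"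
    by (simp add: monomial_mult_exp[OF adm] inner_vec_def sum_distrib_left mult_ac)
  have "((\<lambda>t. x0 $ i * exp (\<alpha> $ i * \<theta> t)) has_real_derivative power_field \<alpha> j (?x t) $ i)
      (at t within T)" for i
    by (rule derivative_eq_intros \<theta>[OF t] refl)+ (simp add: power_field_def m)
  then have "((\<lambda>t. ?x t) has_derivative (\<lambda>h. \<chi> i. power_field \<alpha> j (?x t) $ i * h)) (at t within T)"
    by (intro has_derivative_vec_lambda) (simp add: has_field_derivative_def)
  then show "(?x has_vector_derivative power_field \<alpha> j (?x t)) (at t within T)"
    unfolding has_vector_derivative_def
    by (rule has_derivative_eq_rhs) (simp add: fun_eq_iff vec_eq_iff mult.commute)
qed

lemma phase_space_mult_exp:
  "x \<in> phase_space F \<Longrightarrow> (\<chi> i. x $ i * exp (z i)) \<in> phase_space F"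
  by (simp add: phase_space_def split: if_splits)

lemma solution_on_explicit_flow:
  assumes adm: "admissible j x0" and x0: "x0 \<in> phase_space F"
    and pos: "\<And>t. t \<in> T \<Longrightarrow> (\<alpha> \<bullet> j) * monomial j x0 * (t - t0) < 1"
  shows "solution_on (phase_space F) (power_field \<alpha> j) T (explicit_flow \<alpha> j t0 x0)"
proof -
  define c u where "c = \<alpha> \<bullet> j" and "u = monomial j x0"
  \<comment> \<open>Separation of variables in \<theta>' = u exp (c \<theta>) with \<theta> = 0 at
    \<open>t0\<close>. The logarithm is defined as long as c u (t - t0) < 1.\<close>
  define \<theta> where "\<theta> t = (if c = 0 then u * (t - t0) else - (ln (1 - c * u * (t - t0)) / c))" for t
  have flow: "explicit_flow \<alpha> j t0 x0 t = (\<chi> i. x0 $ i * exp (\<alpha> $ i * \<theta> t))" if "t \<in> T" for t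
    using pos[OF that]
    by (auto simp: explicit_flow_def \<theta>_def Let_def c_def[symmetric] u_def[symmetric] powr_def vec_eq_iff)
  have "(\<theta> has_real_derivative u * exp (c * \<theta> t)) (at t within T)" if "t \<in> T" for t
  proof (cases "c = 0")
    case True
    then show ?thesis
      unfolding \<theta>_def by (auto intro!: derivative_eq_intros)
  next
    case False
    have p: "1 - c * u * (t - t0) > 0"
      using pos[OF that] by (simp add: c_def u_def)
    have "((\<lambda>t. ln (1 - c * u * (t - t0))) has_real_derivative
        - (c * u) / (1 - c * u * (t - t0))) (at t within T)"
      using p by (auto intro!: derivative_eq_intros)
    from DERIV_minus[OF DERIV_cdivide[OF this, of c]]
    have "((\<lambda>t. - (ln (1 - c * u * (t - t0)) / c)) has_real_derivative
        u / (1 - c * u * (t - t0))) (at t within T)"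
      using False by simp
    moreover have "exp (c * \<theta> t) = 1 / (1 - c * u * (t - t0))"
      using p False by (simp add: \<theta>_def exp_minus field_simps)
    ultimately show ?thesis
      using False by (simp add: \<theta>_def[abs_def])
  qed
  then have "solution_on (phase_space F) (power_field \<alpha> j) T (\<lambda>t. \<chi> i. x0 $ i * exp (\<alpha> $ i * \<theta> t))"
    by (intro solution_on_exp adm phase_space_mult_exp x0) (simp add: c_def u_def)
  \<comment> \<open>The two expressions have been identified only on \<open>T\<close>, which
    suffices for derivatives within \<open>T\<close>.\<close>
  moreover have "(explicit_flow \<alpha> j t0 x0 has_vector_derivative v) (at t within T)"
    if "((\<lambda>t. \<chi> i. x0 $ i * exp (\<alpha> $ i * \<theta> t)) has_vector_derivative v) (at t within T)" "t \<in> T" for t v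
    using has_vector_derivative_transform[OF that(2) flow that(1)] .
  ultimately show ?thesis
    by (simp add: solution_on_def flow)
qed

section \<open>Integrals of motion and integrability\<close>

text \<open>The square makes the logarithm smooth on negative coordinates too;
  \<open>ln ((x $ i)\<^sup>2)\<close> is twice the logarithm of the absolute value, hence the factor
  2.\<close>

lemma GDERIV_log_sum:
  assumes "\<And>i. x $ i \<noteq> 0"
  shows "GDERIV (\<lambda>x. \<Sum>i\<in>UNIV. b $ i * ln ((x $ i)\<^sup>2)) x :> (\<chi> i. 2 * b $ i / x $ i)"
proof -
  have "((\<lambda>y. b $ i * ln ((y $ i)\<^sup>2)) has_derivative (\<lambda>h. h $ i * (2 * b $ i / x $ i))) (at x)" for i
  proof -
    have "x $ i * x $ i > 0"
      by (metis assms not_real_square_gt_zero)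
    then have "((\<lambda>y. b $ i * ln (y\<^sup>2)) has_real_derivative 2 * b $ i / x $ i) (at (x $ i))"
      using assms[of i]
      by (auto intro!: derivative_eq_intros simp: power2_eq_square field_simps)
    from has_derivative_compose[OF bounded_linear_imp_has_derivative[OF bounded_linear_vec_nth]
        this[unfolded has_field_derivative_def]]
    show ?thesis
      by (simp add: mult.commute)
  qed
  then have "((\<lambda>y. \<Sum>i\<in>UNIV. b $ i * ln ((y $ i)\<^sup>2)) has_derivative
      (\<lambda>h. \<Sum>i\<in>UNIV. h $ i * (2 * b $ i / x $ i))) (at x)"
    by (intro has_derivative_sum)
  then show ?thesis
    by (simp add: gderiv_def inner_vec_def)
qed

text \<open>The logarithm of each squared coordinate grows at rate 2 \<alpha>_i u with a common u,
  so the weighted sum grows at rate 2 u (\<alpha> \<bullet> b) = 0.\<close>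

lemma integral_of_motion_log_sum:
  fixes D :: "(real ^ 'n) set"
  assumes nz: "\<And>x i. x \<in> D \<Longrightarrow> x $ i \<noteq> 0" and orth: "\<alpha> \<bullet> b = 0"
  shows "integral_of_motion D (power_field \<alpha> j) (\<lambda>x. \<Sum>i\<in>UNIV. b $ i * ln ((x $ i)\<^sup>2))"
  unfolding integral_of_motion_def
proof (intro allI impI)
  fix T and x :: "real \<Rightarrow> real ^ 'n"
  assume "is_interval T \<and> solution_on D (power_field \<alpha> j) T x"
  then have T: "convex T" and sol: "solution_on D (power_field \<alpha> j) T x"
    by (auto simp: is_interval_convex_1)
  let ?H = "\<lambda>t. \<Sum>i\<in>UNIV. b $ i * ln ((x t $ i)\<^sup>2)"
  have "(?H has_real_derivative 0) (at t within T)" if t: "t \<in> T" for t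
  proof -
    have nzt: "x t $ i \<noteq> 0" for i
      using sol t nz by (simp add: solution_on_def)
    have pos: "x t $ i * x t $ i > 0" for i
      by (metis nzt not_real_square_gt_zero)
    have "((\<lambda>t. b $ i * ln ((x t $ i)\<^sup>2)) has_real_derivative
        \<alpha> $ i * b $ i * (2 * monomial j (x t))) (at t within T)" for i
      using nzt[of i] pos[of i]
      by (auto intro!: derivative_eq_intros solution_on_component[OF sol t]
          simp: power_field_def power2_eq_square)
    then have "(?H has_real_derivative (\<Sum>i\<in>UNIV. \<alpha> $ i * b $ i * (2 * monomial j (x t)))) (at t within T)"
      by (intro DERIV_sum)
    moreover have "(\<Sum>i\<in>UNIV. \<alpha> $ i * b $ i * (2 * monomial j (x t))) = 0"
      using orth by (simp add: sum_distrib_right[symmetric] inner_vec_def)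
    ultimately show ?thesis by simp
  qed
  from has_field_derivative_zero_constant[OF T this]
  show "(\<lambda>t. ?H t) constant_on T"
    by (simp add: constant_on_def)
qed

lemma independent_orthogonal_complement:
  fixes \<alpha> :: "'a :: euclidean_space"
  obtains B where "independent B" "card B = DIM('a) - 1" "\<And>b. b \<in> B \<Longrightarrow> \<alpha> \<bullet> b = 0"
proof -
  \<comment> \<open>For \<alpha> = 0 the orthogonal complement is the whole space. Any nonzero
    \<beta> then serves instead, so that the hyperplane has dimension exactly one less than the
    space.\<close>
  obtain \<beta> :: 'a where \<beta>: "\<beta> \<noteq> 0" "\<And>b. \<beta> \<bullet> b = 0 \<Longrightarrow> \<alpha> \<bullet> b = 0"
  proof (cases "\<alpha> = 0")
    case True
    then show ?thesis
      using that[of "SOME i. i \<in> Basis"] SOME_Basis nonzero_Basis by auto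
  next
    case False
    then show ?thesis
      using that[of \<alpha>] by auto
  qed
  obtain B where "B \<subseteq> {b. \<beta> \<bullet> b = 0}" "independent B" "card B = dim {b. \<beta> \<bullet> b = 0}"
    by (rule basis_exists)
  with \<beta> show ?thesis
    by (intro that[of B]) (auto simp: dim_hyperplane)
qed

lemma integrable_power_field:
  fixes D :: "(real ^ 'n) set"
  assumes nz: "\<And>x i. x \<in> D \<Longrightarrow> x $ i \<noteq> 0"
  shows "integrable_system D (power_field \<alpha> j)"
proof -
  obtain B :: "(real ^ 'n) set" where B: "independent B" "card B = CARD('n) - 1"
      "\<And>b. b \<in> B \<Longrightarrow> \<alpha> \<bullet> b = 0"
    using independent_orthogonal_complement[of \<alpha>] by auto
  obtain e where e: "bij_betw e {..<CARD('n) - 1} B"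
    using ex_bij_betw_nat_finite[OF finiteI_independent[OF B(1)]] B(2)
    by (auto simp: lessThan_atLeast0)
  define H where "H k = (\<lambda>x. \<Sum>i\<in>UNIV. e k $ i * ln ((x $ i)\<^sup>2))" for k
  have "integral_of_motion D (power_field \<alpha> j) (H k)" if "k < CARD('n) - 1" for k
    unfolding H_def using e that
    by (intro integral_of_motion_log_sum nz B(3)) (auto simp: bij_betw_def)
  moreover have "gradient_independent_on D (CARD('n) - 1) H"
    unfolding gradient_independent_on_def
  proof (intro ballI exI conjI allI impI)
    fix x assume x: "x \<in> D"
    \<comment> \<open>The gradients at \<open>x\<close> are the images of the basis vectors under
      this diagonal map. It is injective because no coordinate of \<open>x\<close> vanishes, so it
      preserves independence.\<close>
    define S :: "real ^ 'n \<Rightarrow> real ^ 'n" where "S b = (\<chi> i. 2 * b $ i / x $ i)" for b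
    have S: "linear S" "inj S"
      using nz[OF x]
      by (auto intro!: linearI injI simp: S_def vec_eq_iff algebra_simps add_divide_distrib)
    show "GDERIV (H k) x :> (S \<circ> e) k" for k
      unfolding H_def comp_def S_def by (rule GDERIV_log_sum) (rule nz[OF x])
    show "inj_on (S \<circ> e) {..<CARD('n) - 1}"
      using e S(2) by (auto simp: bij_betw_def intro: comp_inj_on inj_on_subset)
    have "(S \<circ> e) ` {..<CARD('n) - 1} = S ` B"
      using e by (simp only: image_comp[symmetric] bij_betw_imp_surj_on)
    then show "independent ((S \<circ> e) ` {..<CARD('n) - 1})"
      using linear_independent_injective_image[OF S(1) B(1) inj_on_subset[OF S(2)]] by simp
  qed
  ultimately show ?thesis
    unfolding integrable_system_def by blast
qed

section \<open>From the divergence-free field to its elementary fields\<close>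

lemma elementary_field_eq_power_field:
  "elementary_field a j = power_field (\<chi> i. if j $ i = -1 then 0 else a i (j + axis i 1)) j"
  by (auto simp: elementary_field_def power_field_def fun_eq_iff vec_eq_iff)

lemma phase_space_admissible:
  assumes "F = \<int> \<or> F = \<real>" "x \<in> phase_space F" "\<And>i. j $ i \<in> F"
  shows "admissible j x"
  using assms by (auto simp: phase_space_def admissible_def less_imp_neq[symmetric] split: if_splits)

theorem theorem3:
  fixes F :: "real set" and L :: "(real ^ 'n) set" and a :: "'n \<Rightarrow> real ^ 'n \<Rightarrow> real"
  assumes "F = \<int> \<or> F = \<real>"
    and "finite L"
    and "\<And>l i. l \<in> L \<Longrightarrow> l $ i \<in> F"
    and "\<And>i m. m \<notin> L \<Longrightarrow> a i m = 0"
    and "divergence_free_on (phase_space F) (monomial_field L a)"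
  shows "(\<forall>x \<in> phase_space F. divergence (monomial_field L a) x =
            (\<Sum>j \<in> div_exponents L. div_coeff a j * monomial j x)) \<and>
    (\<forall>j \<in> div_exponents L. \<exists>\<alpha> :: real ^ 'n.
       (\<forall>x \<in> phase_space F. \<forall>i.
          elementary_field a j x $ i = \<alpha> $ i * x $ i * monomial j x) \<and>
       divergence_free_on (phase_space F) (elementary_field a j) \<and>
       integrable_system (phase_space F) (elementary_field a j) \<and>
       (\<forall>t0 \<Delta>t. \<forall>x0 \<in> phase_space F.
          \<Delta>t > 0 \<and> (\<alpha> \<bullet> j \<noteq> 0 \<longrightarrow> \<Delta>t < 1 / \<bar>(\<alpha> \<bullet> j) * monomial j x0\<bar>) \<longrightarrow>
          solution_on (phase_space F) (elementary_field a j) {t0..t0 + \<Delta>t}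
            (explicit_flow \<alpha> j t0 x0) \<and>
          explicit_flow \<alpha> j t0 x0 t0 = x0 \<and>
          (\<forall>x. solution_on (phase_space F) (elementary_field a j) {t0..t0 + \<Delta>t} x \<and>
             x t0 = x0 \<longrightarrow>
             (\<forall>t \<in> {t0..t0 + \<Delta>t}. x t = explicit_flow \<alpha> j t0 x0 t))))"
proof -
  let ?D = "phase_space F"
  have F: "F = \<int> \<or> F = \<real>" by fact
  have adm_L: "admissible l x" if "l \<in> L" "x \<in> ?D" for l x
    using that assms(3) by (intro phase_space_admissible[OF F]) auto
  have div: "divergence (monomial_field L a) x = (\<Sum>j\<in>div_exponents L. div_coeff a j * monomial j x)"
    if "x \<in> ?D" for x
    using that assms(2,4) adm_L by (intro divergence_monomial_field) auto
  have coeff: "div_coeff a j = 0" if "j \<in> div_exponents L" for j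
  proof (rule sum_exp_inner_eq_zero[OF finite_div_exponents[OF assms(2)] _ that])
    fix y :: "real ^ 'n"
    \<comment> \<open>Points with positive coordinates belong to both kinds of phase space, and on
      them monomials become exponentials of linear forms.\<close>
    have D: "(\<chi> i. exp (y $ i)) \<in> ?D"
      by (simp add: phase_space_def)
    with assms(5) have "divergence (monomial_field L a) (\<chi> i. exp (y $ i)) = 0"
      by (simp add: divergence_free_on_def)
    then show "(\<Sum>j\<in>div_exponents L. div_coeff a j * exp (j \<bullet> y)) = 0"
      by (simp add: div[OF D] monomial_exp)
  qed
  have elem: "\<exists>\<alpha> :: real ^ 'n.
       (\<forall>x \<in> ?D. \<forall>i. elementary_field a j x $ i = \<alpha> $ i * x $ i * monomial j x) \<and>
       divergence_free_on ?D (elementary_field a j) \<and>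
       integrable_system ?D (elementary_field a j) \<and>
       (\<forall>t0 \<Delta>t. \<forall>x0 \<in> ?D.
          \<Delta>t > 0 \<and> (\<alpha> \<bullet> j \<noteq> 0 \<longrightarrow> \<Delta>t < 1 / \<bar>(\<alpha> \<bullet> j) * monomial j x0\<bar>) \<longrightarrow>
          solution_on ?D (elementary_field a j) {t0..t0 + \<Delta>t} (explicit_flow \<alpha> j t0 x0) \<and>
          explicit_flow \<alpha> j t0 x0 t0 = x0 \<and>
          (\<forall>x. solution_on ?D (elementary_field a j) {t0..t0 + \<Delta>t} x \<and> x t0 = x0 \<longrightarrow>
             (\<forall>t \<in> {t0..t0 + \<Delta>t}. x t = explicit_flow \<alpha> j t0 x0 t)))"
    if j: "j \<in> div_exponents L" for j
  proof -
    define \<alpha> :: "real ^ 'n" where "\<alpha> = (\<chi> i. if j $ i = -1 then 0 else a i (j + axis i 1))"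
    have field: "elementary_field a j = power_field \<alpha> j"
      by (simp add: elementary_field_eq_power_field \<alpha>_def)
    \<comment> \<open>Passing from \<open>l\<close> to \<open>j\<close> lowers one exponent by 1,
      which leaves both \<open>\<int>\<close> and \<open>\<real>\<close> invariant.\<close>
    have "j $ i \<in> F" for i
      using j F assms(3) by (auto simp: div_exponents_def axis_def)
    then have adm: "admissible j x" if "x \<in> ?D" for x
      using that by (intro phase_space_admissible[OF F]) auto
    then have nz: "x $ i \<noteq> 0" if "x \<in> ?D" for x :: "real ^ 'n" and i
      using adm[OF that] by (simp add: admissible_def)
    \<comment> \<open>Replacing a coefficient by 0 where \<open>j $ i = -1\<close> does not change
      the sum, since \<open>j $ i + 1\<close> vanishes there. The divergence factor is therefore the
      coefficient already shown to be 0.\<close>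
    have "(\<Sum>i\<in>UNIV. (j $ i + 1) * \<alpha> $ i) = div_coeff a j"
      unfolding div_coeff_def by (intro sum.cong) (auto simp: \<alpha>_def)
    then have "divergence_free_on ?D (power_field \<alpha> j)"
      using coeff[OF j] power_field_has_derivative[OF adm] divergence_power_field[OF adm]
      by (auto simp: divergence_free_on_def differentiable_def)
    moreover have "integrable_system ?D (power_field \<alpha> j)"
      by (intro integrable_power_field nz)
    moreover have init: "explicit_flow \<alpha> j t0 x0 t0 = x0" for t0 x0
      by (simp add: explicit_flow_def Let_def vec_eq_iff)
    moreover have flow: "solution_on ?D (power_field \<alpha> j) {t0..t0 + \<Delta>t} (explicit_flow \<alpha> j t0 x0)"
      if x0: "x0 \<in> ?D" and \<Delta>t: "\<alpha> \<bullet> j \<noteq> 0 \<longrightarrow> \<Delta>t < 1 / \<bar>(\<alpha> \<bullet> j) * monomial j x0\<bar>" for t0 \<Delta>t x0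
    proof (intro solution_on_explicit_flow adm x0)
      fix t assume t: "t \<in> {t0..t0 + \<Delta>t}"
      let ?k = "(\<alpha> \<bullet> j) * monomial j x0"
      show "?k * (t - t0) < 1"
      proof (cases "\<alpha> \<bullet> j = 0")
        case False
        then have k: "\<bar>?k\<bar> > 0"
          using monomial_nonzero[of x0 j] nz[OF x0] by simp
        \<comment> \<open>The absolute value covers both signs of \<open>?k\<close>, and
          \<open>0 \<le> t - t0 \<le> \<Delta>t\<close> bounds the elapsed time.\<close>
        have "?k * (t - t0) \<le> \<bar>?k\<bar> * \<Delta>t"
          using t by (intro mult_mono) auto
        also have "\<dots> < 1"
          using \<Delta>t False k by (simp add: field_simps)
        finally show ?thesis .
      qed simp
    qed
    moreover have "x t = explicit_flow \<alpha> j t0 x0 t"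
      if "x0 \<in> ?D" "\<alpha> \<bullet> j \<noteq> 0 \<longrightarrow> \<Delta>t < 1 / \<bar>(\<alpha> \<bullet> j) * monomial j x0\<bar>"
        "solution_on ?D (power_field \<alpha> j) {t0..t0 + \<Delta>t} x" "x t0 = x0" "t \<in> {t0..t0 + \<Delta>t}"
      for t0 \<Delta>t x0 x t
    proof (rule power_field_solution_unique[OF that(3) flow[OF that(1,2)]])
      show "convex {t0..t0 + \<Delta>t}"
        by simp
      show "t0 \<in> {t0..t0 + \<Delta>t}" "t \<in> {t0..t0 + \<Delta>t}"
        using that(5) by auto
      show "x t0 = explicit_flow \<alpha> j t0 x0 t0"
        by (simp add: init that(4))
    qed (rule adm)
    moreover have "power_field \<alpha> j x $ i = \<alpha> $ i * x $ i * monomial j x" for x i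
      by (simp add: power_field_def)
    ultimately show ?thesis
      unfolding field by (intro exI[of _ \<alpha>]) blast
  qed
  show ?thesis
    using div elem by blast
qed

end
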